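(* Let $\succeq_1,\succeq_2$ be two complete and transitive preference relations on $L^\infty$. They satisfy the axioms Consistency of Combined Choices, Continuity, and Responsiveness if and only if there exists a monotone additive statistic $\Phi\colon L^\infty\to\mathbb{R}$ that represents both $\succeq_1$ and $\succeq_2$, i.e. for $i=1,2$, $X\succeq_iY$ if and only if $\Phi(X)\ge\Phi(Y)$.
   Context: $L^\infty$ is the set of bounded real random variables on a fixed nonatomic probability space; constants are identified with constant random variables. $X\ge_1Y$ denotes first-order stochastic dominance ($\mathbb{P}[X\le t]\le\mathbb{P}[Y\le t]$ for all $t$); dominance is strict if in addition $X$ and $Y$ have different distributions. $\succ_i$ is the strict part of $\succeq_i$. A monotone additive statistic is a map $\Phi\colon L^\infty\to\mathbb{R}$ such that $\Phi(X)=\Phi(Y)$ whenever $X,Y$ have the same distribution; $\Phi(c)=c$ for all $c\in\mathbb{R}$; $\Phi(X+Y)=\Phi(X)+\Phi(Y)$ for independent $X,Y$; and $X\ge_1Y$ implies $\Phi(X)\ge\Phi(Y)$. Axioms: - Consistency of Combined Choices: Suppose $X,X'$ are independent of $Y,Y'$. If $X\succ_1X'$ and $Y\succ_2Y'$, then $X'+Y'$ does not strictly dominate $X+Y$ in first-order stochastic dominance. - Continuity (for $i=1,2$): If $X\succ_iY$ then there exists $\varepsilon>0$ such that $X\succ_iY+\varepsilon$ and $X-\varepsilon\succ_iY$. - Responsiveness (for $i=1,2$): $X+\varepsilon\succ_iX$ for every $X\in L^\infty$ and every $\varepsilon>0$. *)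

theory Defs
  imports "HOL-Probability.Probability"
begin

definition nonatomic :: "'a measure \<Rightarrow> bool" where
  "nonatomic M \<longleftrightarrow>
     (\<forall>A\<in>sets M. 0 < emeasure M A \<longrightarrow>
        (\<exists>B\<in>sets M. B \<subseteq> A \<and> 0 < emeasure M B \<and> emeasure M B < emeasure M A))"

(* Random variables are functions, not classes of almost surely equal functions. *)
definition Linfty :: "'a measure \<Rightarrow> ('a \<Rightarrow> real) set" where
  "Linfty M = {X \<in> borel_measurable M. bounded (X ` space M)}"

definition same_distr :: "'a measure \<Rightarrow> ('a \<Rightarrow> real) \<Rightarrow> ('a \<Rightarrow> real) \<Rightarrow> bool" where
  "same_distr M X Y \<longleftrightarrow> distr M borel X = distr M borel Y"

definition fosd :: "'a measure \<Rightarrow> ('a \<Rightarrow> real) \<Rightarrow> ('a \<Rightarrow> real) \<Rightarrow> bool" where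
  "fosd M X Y \<longleftrightarrow> (\<forall>t. \<P>(\<omega> in M. X \<omega> \<le> t) \<le> \<P>(\<omega> in M. Y \<omega> \<le> t))"

definition strict_fosd :: "'a measure \<Rightarrow> ('a \<Rightarrow> real) \<Rightarrow> ('a \<Rightarrow> real) \<Rightarrow> bool" where
  "strict_fosd M X Y \<longleftrightarrow> fosd M X Y \<and> \<not> same_distr M X Y"

definition monotone_additive_statistic :: "'a measure \<Rightarrow> (('a \<Rightarrow> real) \<Rightarrow> real) \<Rightarrow> bool" where
  "monotone_additive_statistic M \<Phi> \<longleftrightarrow>
     (\<forall>X\<in>Linfty M. \<forall>Y\<in>Linfty M. same_distr M X Y \<longrightarrow> \<Phi> X = \<Phi> Y) \<and>
     (\<forall>c. \<Phi> (\<lambda>_. c) = c) \<and>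
     (\<forall>X\<in>Linfty M. \<forall>Y\<in>Linfty M. prob_space.indep_var M borel X borel Y \<longrightarrow>
        \<Phi> (\<lambda>\<omega>. X \<omega> + Y \<omega>) = \<Phi> X + \<Phi> Y) \<and>
     (\<forall>X\<in>Linfty M. \<forall>Y\<in>Linfty M. fosd M X Y \<longrightarrow> \<Phi> X \<ge> \<Phi> Y)"

(* A preference is a relation R with R X Y read as "X is weakly preferred to Y". *)
definition complete_on :: "'b set \<Rightarrow> ('b \<Rightarrow> 'b \<Rightarrow> bool) \<Rightarrow> bool" where
  "complete_on S R \<longleftrightarrow> (\<forall>X\<in>S. \<forall>Y\<in>S. R X Y \<or> R Y X)"

definition strict_part :: "('b \<Rightarrow> 'b \<Rightarrow> bool) \<Rightarrow> 'b \<Rightarrow> 'b \<Rightarrow> bool" where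
  "strict_part R X Y \<longleftrightarrow> R X Y \<and> \<not> R Y X"

(* The pair (X, X') is independent of the pair (Y, Y') as random vectors in the plane, which
   is more than independence of each of X, X' from each of Y, Y'. *)
definition consistency_of_combined_choices ::
  "'a measure \<Rightarrow> (('a \<Rightarrow> real) \<Rightarrow> ('a \<Rightarrow> real) \<Rightarrow> bool)
     \<Rightarrow> (('a \<Rightarrow> real) \<Rightarrow> ('a \<Rightarrow> real) \<Rightarrow> bool) \<Rightarrow> bool" where
  "consistency_of_combined_choices M R1 R2 \<longleftrightarrow>
     (\<forall>X\<in>Linfty M. \<forall>X'\<in>Linfty M. \<forall>Y\<in>Linfty M. \<forall>Y'\<in>Linfty M.
        prob_space.indep_var M (borel \<Otimes>\<^sub>M borel) (\<lambda>\<omega>. (X \<omega>, X' \<omega>))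
                               (borel \<Otimes>\<^sub>M borel) (\<lambda>\<omega>. (Y \<omega>, Y' \<omega>)) \<longrightarrow>
        strict_part R1 X X' \<longrightarrow> strict_part R2 Y Y' \<longrightarrow>
        \<not> strict_fosd M (\<lambda>\<omega>. X' \<omega> + Y' \<omega>) (\<lambda>\<omega>. X \<omega> + Y \<omega>))"

definition pref_continuous :: "'a measure \<Rightarrow> (('a \<Rightarrow> real) \<Rightarrow> ('a \<Rightarrow> real) \<Rightarrow> bool) \<Rightarrow> bool" where
  "pref_continuous M R \<longleftrightarrow>
     (\<forall>X\<in>Linfty M. \<forall>Y\<in>Linfty M. strict_part R X Y \<longrightarrow>
        (\<exists>\<epsilon>>0. strict_part R X (\<lambda>\<omega>. Y \<omega> + \<epsilon>) \<and> strict_part R (\<lambda>\<omega>. X \<omega> - \<epsilon>) Y))"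

definition responsive :: "'a measure \<Rightarrow> (('a \<Rightarrow> real) \<Rightarrow> ('a \<Rightarrow> real) \<Rightarrow> bool) \<Rightarrow> bool" where
  "responsive M R \<longleftrightarrow> (\<forall>X\<in>Linfty M. \<forall>\<epsilon>>0. strict_part R (\<lambda>\<omega>. X \<omega> + \<epsilon>) X)"

definition represents ::
  "'a measure \<Rightarrow> (('a \<Rightarrow> real) \<Rightarrow> real) \<Rightarrow> (('a \<Rightarrow> real) \<Rightarrow> ('a \<Rightarrow> real) \<Rightarrow> bool) \<Rightarrow> bool" where
  "represents M \<Phi> R \<longleftrightarrow> (\<forall>X\<in>Linfty M. \<forall>Y\<in>Linfty M. R X Y \<longleftrightarrow> \<Phi> X \<ge> \<Phi> Y)"

end

theory Submission
  imports Defs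
begin

text \<open>Combining a choice with a small gain makes each preference monotone in first-order dominance, and
continuity then yields certainty equivalents $\Phi_1$, $\Phi_2$. If $X'$ is an independent copy of $X$,
then $X + d'$ and $X' + c + d$ are ordered in distribution by $d'$ and $c + d$; consistency, applied to the
choices $X$ versus $d$ and $d'$ versus $X' + c$, forces $\Phi_2(X + c) = \Phi_1(X) + c$, so both statistics
agree and are translation equivariant. Additivity follows in the same way from $X + Y$ versus
$Y + c$ and $d$ versus $X'$, where $X'$ is a copy of $X$ independent of $(X, Y)$. Such copies are needed
only for simple random variables, since translation equivariance and monotonicity control the error of
uniform approximation; for these they are obtained by splitting events of a nonatomic space.\<close>

subsection \<open>Independent copies on nonatomic spaces\<close>


text \<open>Repeated halving: when a set of positive measure is split into two pieces of positive
  measure, one of them has at most half of the measure. After enough halvings the measure is below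
  \<open>e\<close>.\<close>

lemma (in finite_measure) nonatomic_small_subset:
  assumes na: "nonatomic M" and A: "A \<in> sets M" "0 < measure M A" and e: "0 < e"
  shows "\<exists>B\<in>sets M. B \<subseteq> A \<and> 0 < measure M B \<and> measure M B < e"
proof -
  have half: "\<exists>B\<in>sets M. B \<subseteq> C \<and> 0 < measure M B \<and> measure M B \<le> measure M C / 2"
    if C: "C \<in> sets M" "0 < measure M C" for C
  proof -
    have "0 < emeasure M C" using C by (simp add: emeasure_eq_measure)
    then obtain B where B: "B \<in> sets M" "B \<subseteq> C" "0 < emeasure M B" "emeasure M B < emeasure M C"
      using na C unfolding nonatomic_def by blast
    have m: "0 < measure M B" "measure M B < measure M C"
      using B by (auto simp: emeasure_eq_measure ennreal_less_iff)
    have d: "measure M (C - B) = measure M C - measure M B"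
      using B C by (intro finite_measure_Diff) auto
    show ?thesis
    proof (cases "measure M B \<le> measure M C / 2")
      case True
      then show ?thesis using B m by blast
    next
      case False
      then have "C - B \<in> sets M" "C - B \<subseteq> C" "0 < measure M (C - B)" "measure M (C - B) \<le> measure M C / 2"
        using B C m d by auto
      then show ?thesis by blast
    qed
  qed
  have pow: "\<exists>B\<in>sets M. B \<subseteq> A \<and> 0 < measure M B \<and> measure M B \<le> measure M A * (1/2)^n" for n
  proof (induction n)
    case 0
    then show ?case using A by auto
  next
    case (Suc n)
    then obtain B where B: "B\<in>sets M" "B \<subseteq> A" "0 < measure M B" "measure M B \<le> measure M A * (1/2)^n"
      by blast
    obtain C where C: "C \<in> sets M" "C \<subseteq> B" "0 < measure M C" "measure M C \<le> measure M B / 2"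
      using half[OF B(1,3)] by blast
    have "measure M C \<le> measure M A * (1/2)^Suc n" using B(4) C(4) by simp
    then show ?case using B C by blast
  qed
  obtain n where "(1/2)^n < e / measure M A"
    using real_arch_pow_inv[of "e / measure M A" "1/2"] A e by auto
  then have "measure M A * (1/2)^n < e" using A by (simp add: field_simps)
  then show ?thesis using pow[of n] le_less_trans by blast
qed

text \<open>Greedy exhaustion: each step adds a set of at least half the largest measure that still fits.\<close>
lemma (in finite_measure) nonatomic_intermediate:
  assumes na: "nonatomic M" and A: "A \<in> sets M" and t: "0 \<le> t" "t \<le> measure M A"
  shows "\<exists>B\<in>sets M. B \<subseteq> A \<and> measure M B = t"
proof -
  define P where "P B \<longleftrightarrow> B \<in> sets M \<and> B \<subseteq> A \<and> measure M B \<le> t" for B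
  define fits where "fits B C \<longleftrightarrow> C \<in> sets M \<and> C \<subseteq> A - B \<and> measure M B + measure M C \<le> t" for B C
  \<comment> \<open>\<open>fits B C\<close> says that \<open>C\<close> can still be added to
    \<open>B\<close> without exceeding \<open>t\<close>. The claim bounds every fitting set by twice
    the gain of the step, so once the gains tend to zero no set of positive measure can fit at every
    stage.\<close>
  have step: "\<exists>B'. P B' \<and> B \<subseteq> B' \<and> (\<forall>C. fits B C \<longrightarrow> measure M C \<le> 2 * (measure M B' - measure M B))"
    if B: "P B" for B
  proof -
    let ?S = "measure M ` {C. fits B C}"
    have bdd: "bdd_above ?S" by (rule bdd_aboveI[of _ "measure M (space M)"]) (auto intro: bounded_measure)
    have e: "fits B {}" using B by (auto simp: P_def fits_def)
    have up: "measure M C \<le> Sup ?S" if "fits B C" for C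
      using that bdd by (intro cSup_upper) auto
    show ?thesis
    \<comment> \<open>The empty set fits, so the supremum is at least zero. If it is zero, only null
      sets fit and \<open>B\<close> itself continues the sequence; otherwise some fitting set has
      more than half the supremum.\<close>
    proof (cases "Sup ?S \<le> 0")
      case True
      then have "\<forall>C. fits B C \<longrightarrow> measure M C \<le> 2 * (measure M B - measure M B)"
        using up by force
      then show ?thesis using B by blast
    next
      case False
      then have "Sup ?S / 2 < Sup ?S" by simp
      then obtain C where C: "fits B C" "Sup ?S / 2 < measure M C"
        using less_cSupE[of "Sup ?S / 2" ?S] e by auto
      have m: "measure M (B \<union> C) = measure M B + measure M C"
        using B C by (intro finite_measure_Union) (auto simp: P_def fits_def)
      have "P (B \<union> C)" using B C m by (auto simp: P_def fits_def)
      moreover have "measure M D \<le> 2 * (measure M (B \<union> C) - measure M B)" if "fits B D" for D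
        using up[OF that] C m by simp
      ultimately show ?thesis by blast
    qed
  qed
  have "P {}" using t by (auto simp: P_def)
  then have "\<exists>f. \<forall>n. P (f n) \<and> (f n \<subseteq> f (Suc n) \<and>
      (\<forall>C. fits (f n) C \<longrightarrow> measure M C \<le> 2 * (measure M (f (Suc n)) - measure M (f n))))"
    using step by (intro dependent_nat_choice) auto
  then obtain f where f: "\<And>n. P (f n)" "\<And>n. f n \<subseteq> f (Suc n)"
      "\<And>n C. fits (f n) C \<Longrightarrow> measure M C \<le> 2 * (measure M (f (Suc n)) - measure M (f n))"
    by auto
  let ?B = "\<Union>n. f n"
  have fs: "f n \<in> sets M" "f n \<subseteq> A" "measure M (f n) \<le> t" for n using f(1) by (auto simp: P_def)
  have B: "?B \<in> sets M" "?B \<subseteq> A" using fs by auto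
  have lim: "(\<lambda>n. measure M (f n)) \<longlonglongrightarrow> measure M ?B"
    using fs f(2) by (intro finite_Lim_measure_incseq incseq_SucI) auto
  have le: "measure M ?B \<le> t" using lim fs(3) by (intro LIMSEQ_le_const2[OF lim]) auto
  have "measure M ?B = t"
  proof (rule ccontr)
    assume "measure M ?B \<noteq> t"
    then have lt: "measure M ?B < t" using le by simp
    have "measure M (A - ?B) = measure M A - measure M ?B"
      using A B by (intro finite_measure_Diff) auto
    then have "0 < measure M (A - ?B)" using lt t by simp
    then obtain C where C: "C \<in> sets M" "C \<subseteq> A - ?B" "0 < measure M C" "measure M C < t - measure M ?B"
      using nonatomic_small_subset[OF na, of "A - ?B" "t - measure M ?B"] A B lt by auto
    \<comment> \<open>\<open>C\<close> avoids the whole union and is smaller than the shortfall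
      \<open>t - measure M ?B\<close>, hence it fits at every stage. Its measure is then at most
      twice each gain, and these tend to zero because the measures of the \<open>f n\<close>
      converge.\<close>
    have "fits (f n) C" for n
    proof -
      have "measure M (f n) \<le> measure M ?B" using fs B by (intro finite_measure_mono) auto
      then show ?thesis using C by (auto simp: fits_def)
    qed
    then have "measure M C \<le> 2 * (measure M (f (Suc n)) - measure M (f n))" for n using f(3) by blast
    moreover have "(\<lambda>n. 2 * (measure M (f (Suc n)) - measure M (f n))) \<longlonglongrightarrow> 2 * (measure M ?B - measure M ?B)"
      by (intro tendsto_intros lim LIMSEQ_Suc)
    ultimately have "measure M C \<le> 2 * (measure M ?B - measure M ?B)"
      by (intro LIMSEQ_le_const) auto
    then show False using C by simp
  qed
  then show ?thesis using B by blast
qed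

text \<open>Induction on the set of values: a piece of measure \<open>p v\<close> is carved out of
  \<open>A\<close> and given the value \<open>v\<close>, and the rest of \<open>A\<close> is split
  among the other values. Nothing is prescribed outside \<open>A\<close>, so functions built for
  different cells can be glued.\<close>

lemma (in finite_measure) nonatomic_simple_split:
  fixes p :: "'b \<Rightarrow> real"
  assumes na: "nonatomic M" and V: "finite V" "V \<noteq> {}" and A: "A \<in> sets M"
    and p: "\<And>v. v \<in> V \<Longrightarrow> 0 \<le> p v" "sum p V = measure M A"
  shows "\<exists>f. simple_function M f \<and> (\<forall>\<omega>\<in>A. f \<omega> \<in> V) \<and> (\<forall>v\<in>V. measure M (A \<inter> f -` {v}) = p v)"
  using V A p
proof (induction V arbitrary: A rule: finite_ne_induct)
  case (singleton v)
  then show ?case by (intro exI[of _ "\<lambda>_. v"]) auto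
next
  case (insert v F)
  have "p v \<le> measure M A" using insert by (auto simp flip: insert.prems(3) intro: sum_nonneg)
  then obtain B where B: "B \<in> sets M" "B \<subseteq> A" "measure M B = p v"
    using nonatomic_intermediate[OF na] insert.prems by (meson insertI1)
  have "measure M (A - B) = measure M A - measure M B"
    using insert.prems B by (intro finite_measure_Diff) auto
  then have "sum p F = measure M (A - B)" using insert B by simp
  then obtain g where g: "simple_function M g" "\<forall>\<omega>\<in>A - B. g \<omega> \<in> F"
      "\<forall>u\<in>F. measure M ((A - B) \<inter> g -` {u}) = p u"
    using insert.IH[of "A - B"] insert.prems B by auto
  let ?f = "\<lambda>\<omega>. if \<omega> \<in> B then v else g \<omega>"
  have "simple_function M ?f" using B g by (intro simple_function_If_set) auto
  moreover have "A \<inter> ?f -` {v} = B" using B g insert.hyps by (auto split: if_splits)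
  moreover have "A \<inter> ?f -` {u} = (A - B) \<inter> g -` {u}" if "u \<in> F" for u
    using B that insert.hyps by auto
  ultimately show ?case using B g by (intro exI[of _ ?f]) auto
qed

context prob_space
begin

text \<open>The preimages of measurable sets are closed under intersection, so the product formula
  on them extends to the sigma-algebras that they generate.\<close>

lemma indep_varI:
  assumes X: "random_variable S X" and Y: "random_variable T Y"
    and eq: "\<And>A B. A \<in> sets S \<Longrightarrow> B \<in> sets T \<Longrightarrow>
      prob (X -` A \<inter> Y -` B \<inter> space M) = prob (X -` A \<inter> space M) * prob (Y -` B \<inter> space M)"
  shows "indep_var S X T Y"
  unfolding indep_var_eq
proof (intro conjI X Y indep_set_sigma_sets)
  show "Int_stable {X -` A \<inter> space M |A. A \<in> sets S}"
  proof (rule Int_stableI, clarify)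
    fix A B assume "A \<in> sets S" "B \<in> sets S"
    then show "\<exists>C. (X -` A \<inter> space M) \<inter> (X -` B \<inter> space M) = X -` C \<inter> space M \<and> C \<in> sets S"
      by (intro exI[of _ "A \<inter> B"]) auto
  qed
  show "Int_stable {Y -` A \<inter> space M |A. A \<in> sets T}"
  proof (rule Int_stableI, clarify)
    fix A B assume "A \<in> sets T" "B \<in> sets T"
    then show "\<exists>C. (Y -` A \<inter> space M) \<inter> (Y -` B \<inter> space M) = Y -` C \<inter> space M \<and> C \<in> sets T"
      by (intro exI[of _ "A \<inter> B"]) auto
  qed
  have "prob ((X -` A \<inter> space M) \<inter> (Y -` B \<inter> space M)) = prob (X -` A \<inter> space M) * prob (Y -` B \<inter> space M)"
    if "A \<in> sets S" "B \<in> sets T" for A B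
  proof -
    have "(X -` A \<inter> space M) \<inter> (Y -` B \<inter> space M) = X -` A \<inter> Y -` B \<inter> space M" by auto
    then show ?thesis using eq[OF that] by simp
  qed
  then show "indep_set {X -` A \<inter> space M |A. A \<in> sets S} {Y -` A \<inter> space M |A. A \<in> sets T}"
    unfolding indep_sets2_eq using X Y by (auto simp: measurable_sets)
qed

lemma indep_var_map:
  assumes "indep_var S X T Y" "f \<in> measurable S S'" "g \<in> measurable T T'"
  shows "indep_var S' (\<lambda>\<omega>. f (X \<omega>)) T' (\<lambda>\<omega>. g (Y \<omega>))"
  using indep_var_compose[OF assms] by (simp add: comp_def)

lemma indep_var_commute:
  assumes "indep_var S X T Y"
  shows "indep_var T Y S X"
proof (rule indep_varI)
  fix A B assume "A \<in> sets T" "B \<in> sets S"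
  have "Y -` A \<inter> X -` B \<inter> space M = (\<lambda>x. (X x, Y x)) -` (B \<times> A) \<inter> space M" by auto
  then show "prob (Y -` A \<inter> X -` B \<inter> space M) = prob (Y -` A \<inter> space M) * prob (X -` B \<inter> space M)"
    using indep_varD[OF assms, of B A] \<open>A \<in> sets T\<close> \<open>B \<in> sets S\<close> by simp
qed (fact indep_var_rv1[OF assms] indep_var_rv2[OF assms])+

lemma indep_var_const:
  assumes X: "random_variable S X" and c: "c \<in> space T"
  shows "indep_var S X T (\<lambda>_. c)"
proof (rule indep_varI)
  fix A B assume "A \<in> sets S" "B \<in> sets T"
  then show "prob (X -` A \<inter> (\<lambda>_. c) -` B \<inter> space M) = prob (X -` A \<inter> space M) * prob ((\<lambda>_. c) -` B \<inter> space M)"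
    by (cases "c \<in> B") (auto simp: prob_space)
qed (use assms in auto)

text \<open>Each cell of W is split in proportion to the distribution of X.\<close>
lemma nonatomic_indep_copy:
  fixes W X :: "'a \<Rightarrow> 'b"
  assumes na: "nonatomic M" and W: "simple_function M W" and X: "simple_function M X"
  shows "\<exists>X'. simple_function M X' \<and> distr M (count_space UNIV) X' = distr M (count_space UNIV) X \<and>
    indep_var (count_space UNIV) W (count_space UNIV) X'"
proof -
  define D where "D w = W -` {w} \<inter> space M" for w
  define p where "p v = prob (X -` {v} \<inter> space M)" for v
  let ?V = "X ` space M" and ?W = "W ` space M"
  have D: "D w \<in> events" for w unfolding D_def using W by (rule simple_functionD)
  have fin: "finite ?V" "finite ?W" using W X by (auto simp: simple_function_def)
  have ne: "?V \<noteq> {}" using not_empty by auto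
  have sum_p: "sum p (B \<inter> ?V) = prob (X -` B \<inter> space M)" for B
  proof -
    have "sum p (B \<inter> ?V) = prob (\<Union>v\<in>B \<inter> ?V. X -` {v} \<inter> space M)"
      unfolding p_def using fin simple_functionD(2)[OF X]
      by (intro finite_measure_finite_Union[symmetric]) (auto simp: disjoint_family_on_def)
    also have "(\<Union>v\<in>B \<inter> ?V. X -` {v} \<inter> space M) = X -` B \<inter> space M" by auto
    finally show ?thesis .
  qed
  have "sum p ?V = 1" using sum_p[of UNIV] by (simp add: prob_space)
  then have "\<exists>f. simple_function M f \<and> (\<forall>\<omega>\<in>D w. f \<omega> \<in> ?V) \<and>
      (\<forall>v\<in>?V. prob (D w \<inter> f -` {v}) = prob (D w) * p v)" for w
    using fin ne D by (intro nonatomic_simple_split[OF na]) (auto simp: p_def simp flip: sum_distrib_left)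
  then obtain f where f: "\<And>w. simple_function M (f w)" "\<And>w \<omega>. \<omega> \<in> D w \<Longrightarrow> f w \<omega> \<in> ?V"
      "\<And>w v. v \<in> ?V \<Longrightarrow> prob (D w \<inter> f w -` {v}) = prob (D w) * p v"
    by metis
  \<comment> \<open>\<open>f w\<close> splits the cell where \<open>W\<close> equals
    \<open>w\<close>, with conditional weights \<open>p\<close>. Gluing these splits gives the same
    conditional law on every cell, which is the source of independence.\<close>
  define X' where "X' \<omega> = f (W \<omega>) \<omega>" for \<omega>
  have cell: "D w \<inter> f w -` {v} = W -` {w} \<inter> X' -` {v} \<inter> space M" for w v
    by (auto simp: D_def X'_def)
  have cellm: "W -` {w} \<inter> X' -` {v} \<inter> space M \<in> events" for w v
  proof -
    have "W -` {w} \<inter> X' -` {v} \<inter> space M = D w \<inter> (f w -` {v} \<inter> space M)"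
      by (auto simp: D_def X'_def)
    also have "\<dots> \<in> events" using D simple_functionD(2)[OF f(1)] by blast
    finally show ?thesis .
  qed
  have X'V: "X' \<omega> \<in> ?V" if "\<omega> \<in> space M" for \<omega>
    using f(2)[of \<omega> "W \<omega>"] that by (auto simp: X'_def D_def)
  have X': "simple_function M X'"
    unfolding simple_function_def
  proof (intro conjI ballI)
    show "finite (X' ` space M)" using X'V by (intro finite_subset[OF _ fin(1)]) auto
    fix v
    have "X' -` {v} \<inter> space M = (\<Union>w\<in>?W. W -` {w} \<inter> X' -` {v} \<inter> space M)" by auto
    also have "\<dots> \<in> events" using cellm by (intro sets.finite_UN fin) auto
    finally show "X' -` {v} \<inter> space M \<in> events" .
  qed
  \<comment> \<open>Both sides are finite sums over pairs of values, and on a single pair the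
    product form holds by the choice of \<open>f\<close>. Taking \<open>A = UNIV\<close> then gives
    the law of \<open>X'\<close>.\<close>
  have joint: "prob (W -` A \<inter> X' -` B \<inter> space M) = prob (W -` A \<inter> space M) * prob (X -` B \<inter> space M)" for A B
  proof -
    have "W -` A \<inter> X' -` B \<inter> space M = (\<Union>(w, v)\<in>(A \<inter> ?W) \<times> (B \<inter> ?V). W -` {w} \<inter> X' -` {v} \<inter> space M)"
      using X'V by auto
    also have "prob \<dots> = (\<Sum>(w, v)\<in>(A \<inter> ?W) \<times> (B \<inter> ?V). prob (W -` {w} \<inter> X' -` {v} \<inter> space M))"
      using fin cellm unfolding case_prod_unfold
      by (intro finite_measure_finite_Union) (auto simp: disjoint_family_on_def)
    also have "\<dots> = (\<Sum>(w, v)\<in>(A \<inter> ?W) \<times> (B \<inter> ?V). prob (D w) * p v)"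
      using f(3) by (intro sum.cong) (auto simp flip: cell)
    also have "\<dots> = (\<Sum>w\<in>A \<inter> ?W. prob (D w)) * (\<Sum>v\<in>B \<inter> ?V. p v)"
      by (simp add: sum.cartesian_product sum_product)
    also have "(\<Sum>w\<in>A \<inter> ?W. prob (D w)) = prob (\<Union>w\<in>A \<inter> ?W. D w)"
      using fin D by (intro finite_measure_finite_Union[symmetric]) (auto simp: disjoint_family_on_def D_def)
    also have "(\<Union>w\<in>A \<inter> ?W. D w) = W -` A \<inter> space M" by (auto simp: D_def)
    finally show ?thesis by (simp add: sum_p)
  qed
  have marg: "prob (X' -` B \<inter> space M) = prob (X -` B \<inter> space M)" for B
    using joint[of UNIV B] by (simp add: prob_space)
  have rv: "random_variable (count_space UNIV) W" "random_variable (count_space UNIV) X"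
      "random_variable (count_space UNIV) X'"
    using W X X' by (auto intro: measurable_simple_function)
  have "distr M (count_space UNIV) X' = distr M (count_space UNIV) X"
    using rv marg by (intro measure_eqI) (auto simp: emeasure_distr emeasure_eq_measure)
  moreover have "indep_var (count_space UNIV) W (count_space UNIV) X'"
    using rv joint marg by (intro indep_varI) auto
  ultimately show ?thesis using X' by blast
qed

end


subsection \<open>Bounded random variables and first-order dominance\<close>

lemma Linfty_const: "(\<lambda>_. c) \<in> Linfty M"
  by (auto simp: Linfty_def intro: finite_imp_bounded finite_subset[of _ "{c}"])

lemma LinftyI:
  assumes "X \<in> borel_measurable M" "\<And>\<omega>. \<omega> \<in> space M \<Longrightarrow> \<bar>X \<omega>\<bar> \<le> K"
  shows "X \<in> Linfty M"
  using assms by (auto simp: Linfty_def bounded_iff)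

lemma Linfty_measurable: "X \<in> Linfty M \<Longrightarrow> X \<in> borel_measurable M"
  by (simp add: Linfty_def)

lemma Linfty_bounded:
  assumes "X \<in> Linfty M"
  obtains K where "\<And>\<omega>. \<omega> \<in> space M \<Longrightarrow> \<bar>X \<omega>\<bar> \<le> K"
  using assms by (auto simp: Linfty_def bounded_iff)

lemma Linfty_add:
  assumes "X \<in> Linfty M" "Y \<in> Linfty M"
  shows "(\<lambda>\<omega>. X \<omega> + Y \<omega>) \<in> Linfty M"
proof -
  obtain K where K: "\<And>\<omega>. \<omega> \<in> space M \<Longrightarrow> \<bar>X \<omega>\<bar> \<le> K" using Linfty_bounded[OF assms(1)] by blast
  obtain L where L: "\<And>\<omega>. \<omega> \<in> space M \<Longrightarrow> \<bar>Y \<omega>\<bar> \<le> L" using Linfty_bounded[OF assms(2)] by blast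
  show ?thesis
  proof (rule LinftyI)
    show "(\<lambda>\<omega>. X \<omega> + Y \<omega>) \<in> borel_measurable M"
      using assms by (intro borel_measurable_add Linfty_measurable)
    show "\<bar>X \<omega> + Y \<omega>\<bar> \<le> K + L" if "\<omega> \<in> space M" for \<omega>
      using K[OF that] L[OF that] by simp
  qed
qed

lemma Linfty_add_const: "X \<in> Linfty M \<Longrightarrow> (\<lambda>\<omega>. X \<omega> + c) \<in> Linfty M"
  by (intro Linfty_add Linfty_const)

lemma Linfty_diff_const: "X \<in> Linfty M \<Longrightarrow> (\<lambda>\<omega>. X \<omega> - c) \<in> Linfty M"
  using Linfty_add_const[of X M "- c"] by simp

lemma simple_function_Linfty:
  fixes X :: "'a \<Rightarrow> real"
  assumes "simple_function M X"
  shows "X \<in> Linfty M"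
  using assms by (auto simp: Linfty_def simple_function_def finite_imp_bounded intro: borel_measurable_simple_function[OF assms])

text \<open>Boundedness of \<open>X\<close> confines the integer part of \<open>X / e\<close> to a
  finite interval. The absolute value of \<open>e\<close> in the bound makes the argument
  independent of its sign, and \<open>e = 0\<close> is covered by division by zero being
  zero.\<close>

lemma simple_function_floor_Linfty:
  assumes X: "X \<in> Linfty M"
  shows "simple_function M (\<lambda>\<omega>. e * real_of_int \<lfloor>X \<omega> / e\<rfloor>)"
proof (rule simple_function_borel_measurable)
  show "(\<lambda>\<omega>. e * real_of_int \<lfloor>X \<omega> / e\<rfloor>) \<in> borel_measurable M"
    using Linfty_measurable[OF X] by measurable
  obtain K where K: "\<And>\<omega>. \<omega> \<in> space M \<Longrightarrow> \<bar>X \<omega>\<bar> \<le> K" using Linfty_bounded[OF X] by blast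
  have "\<bar>X \<omega> / e\<bar> \<le> K / \<bar>e\<bar>" if "\<omega> \<in> space M" for \<omega>
    using K[OF that] by (simp add: divide_right_mono)
  then have "\<lfloor>X \<omega> / e\<rfloor> \<in> {\<lfloor>- (K / \<bar>e\<bar>)\<rfloor> .. \<lfloor>K / \<bar>e\<bar>\<rfloor>}" if "\<omega> \<in> space M" for \<omega>
    using that unfolding atLeastAtMost_iff
    by (intro conjI floor_mono) (meson abs_le_D1 abs_le_D2 minus_le_iff)+
  then have "(\<lambda>\<omega>. e * real_of_int \<lfloor>X \<omega> / e\<rfloor>) ` space M \<subseteq>
      (\<lambda>i. e * real_of_int i) ` {\<lfloor>- (K / \<bar>e\<bar>)\<rfloor> .. \<lfloor>K / \<bar>e\<bar>\<rfloor>}" by blast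
  then show "finite ((\<lambda>\<omega>. e * real_of_int \<lfloor>X \<omega> / e\<rfloor>) ` space M)"
    by (rule finite_subset) simp
qed

lemma floor_multiple_bounds:
  fixes x e :: real
  assumes "0 < e"
  shows "e * real_of_int \<lfloor>x / e\<rfloor> \<le> x" "x \<le> e * real_of_int \<lfloor>x / e\<rfloor> + e"
proof -
  have "e * real_of_int \<lfloor>x / e\<rfloor> \<le> e * (x / e)" "e * (x / e) \<le> e * (real_of_int \<lfloor>x / e\<rfloor> + 1)"
    by (rule mult_left_mono, linarith, use assms in linarith)+
  then show "e * real_of_int \<lfloor>x / e\<rfloor> \<le> x" "x \<le> e * real_of_int \<lfloor>x / e\<rfloor> + e"
    using assms by (auto simp: distrib_left)
qed

context prob_space
begin

lemma fosd_mono: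
  assumes "X \<in> borel_measurable M" "Y \<in> borel_measurable M" "\<And>\<omega>. \<omega> \<in> space M \<Longrightarrow> Y \<omega> \<le> X \<omega>"
  shows "fosd M X Y"
  unfolding fosd_def
proof
  fix t
  show "\<P>(\<omega> in M. X \<omega> \<le> t) \<le> \<P>(\<omega> in M. Y \<omega> \<le> t)"
    using assms by (intro finite_measure_mono) (auto intro: order_trans)
qed

lemma same_distr_prob_le:
  assumes "same_distr M X Y" and [measurable]: "X \<in> borel_measurable M" "Y \<in> borel_measurable M"
  shows "\<P>(\<omega> in M. X \<omega> \<le> t) = \<P>(\<omega> in M. Y \<omega> \<le> t)"
proof -
  have "measure (distr M borel X) {..t} = measure (distr M borel Y) {..t}"
    using assms(1) by (simp add: same_distr_def)
  moreover have "Z -` {..t} \<inter> space M = {\<omega> \<in> space M. Z \<omega> \<le> t}" for Z :: "'a \<Rightarrow> real" by auto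
  ultimately show ?thesis by (simp add: measure_distr)
qed

lemma same_distr_fosd:
  assumes "same_distr M X Y" "X \<in> borel_measurable M" "Y \<in> borel_measurable M"
  shows "fosd M X Y"
  using same_distr_prob_le[OF assms] by (simp add: fosd_def)

text \<open>If the shifted variables had the same distribution, then the distribution function F of X would
  satisfy F(t) = F(t + a - b) for all t.\<close>
lemma strict_fosd_shift:
  assumes le: "fosd M X Y" and X: "X \<in> Linfty M" and Y: "Y \<in> Linfty M" and ab: "b < a"
  shows "strict_fosd M (\<lambda>\<omega>. X \<omega> + a) (\<lambda>\<omega>. Y \<omega> + b)"
  unfolding strict_fosd_def
proof
  define F where "F t = \<P>(\<omega> in M. X \<omega> \<le> t)" for t
  define G where "G t = \<P>(\<omega> in M. Y \<omega> \<le> t)" for t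
  have [measurable]: "X \<in> borel_measurable M" "Y \<in> borel_measurable M"
    using X Y by (auto intro: Linfty_measurable)
  have sh: "\<P>(\<omega> in M. Z \<omega> + c \<le> t) = \<P>(\<omega> in M. Z \<omega> \<le> t - c)" for Z :: "'a \<Rightarrow> real" and c t
    by (simp add: algebra_simps)
  have FG: "F t \<le> G t" for t using le by (simp add: fosd_def F_def G_def)
  have Fmono: "F s \<le> F t" if "s \<le> t" for s t
    unfolding F_def using that by (intro finite_measure_mono) auto
  have "F (t - a) \<le> G (t - b)" for t using FG[of "t - b"] Fmono[of "t - a" "t - b"] ab by simp
  then show "fosd M (\<lambda>\<omega>. X \<omega> + a) (\<lambda>\<omega>. Y \<omega> + b)" by (simp add: fosd_def sh F_def G_def)
  show "\<not> same_distr M (\<lambda>\<omega>. X \<omega> + a) (\<lambda>\<omega>. Y \<omega> + b)"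
  proof
    assume sd: "same_distr M (\<lambda>\<omega>. X \<omega> + a) (\<lambda>\<omega>. Y \<omega> + b)"
    have eq: "F (t - a) = G (t - b)" for t
      using same_distr_prob_le[OF sd, of t] by (simp add: sh F_def G_def)
    \<comment> \<open>Equality of the shifted laws gives F(t) = G(t + a - b), and F lies below G
      everywhere.\<close>
    have step: "F (t + (a - b)) \<le> F t" for t
      using eq[of "t + a"] FG[of "t + a - b"] by (simp add: algebra_simps)
    have iter: "F (t + real n * (a - b)) \<le> F t" for t n
    proof (induction n)
      case (Suc n)
      then show ?case using step[of "t + real n * (a - b)"] by (simp add: algebra_simps)
    qed simp
    obtain K where K: "\<And>\<omega>. \<omega> \<in> space M \<Longrightarrow> \<bar>X \<omega>\<bar> \<le> K" using Linfty_bounded[OF X] by blast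
    \<comment> \<open>\<open>n\<close> steps of length \<open>a - b\<close> lead from
      \<open>- K - 1\<close>, where F is 0, to a point above \<open>K\<close>, where F is 1.\<close>
    obtain n where n: "2 * K + 1 < real n * (a - b)"
      using reals_Archimedean3[of "a - b"] ab by auto
    have below: "{\<omega> \<in> space M. X \<omega> \<le> - K - 1} = {}" using K by force
    have 0: "F (- K - 1) = 0" by (simp only: F_def below measure_empty)
    have above: "{\<omega> \<in> space M. X \<omega> \<le> - K - 1 + real n * (a - b)} = space M" using K n by force
    have "F (- K - 1 + real n * (a - b)) = 1" by (simp only: F_def above prob_space)
    then show False using iter[of "- K - 1" n] 0 by simp
  qed
qed

text \<open>The copy is built over the discrete sigma-algebra, for which every function is
  measurable; hence arbitrary functions \<open>f\<close> of \<open>W\<close> and \<open>g\<close> of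
  \<open>X'\<close> remain independent. Pairing \<open>X\<close> with 0 gives it the same type of
  values as \<open>W\<close>, as \<open>nonatomic_indep_copy\<close> demands.\<close>

lemma simple_indep_copy:
  fixes W :: "'a \<Rightarrow> real \<times> real" and X :: "'a \<Rightarrow> real"
  assumes "nonatomic M" and W: "simple_function M W" and X: "simple_function M X"
  obtains X' where "simple_function M X'" "same_distr M X' X"
    "\<And>f g :: _ \<Rightarrow> real \<times> real. indep_var (borel \<Otimes>\<^sub>M borel) (\<lambda>\<omega>. f (W \<omega>)) (borel \<Otimes>\<^sub>M borel) (\<lambda>\<omega>. g (X' \<omega>))"
proof -
  have X0: "simple_function M (\<lambda>\<omega>. (X \<omega>, 0 :: real))"
    using simple_function_compose1[OF X, of "\<lambda>x. (x, 0)"] .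
  obtain Z where Z: "simple_function M Z"
      "distr M (count_space UNIV) Z = distr M (count_space UNIV) (\<lambda>\<omega>. (X \<omega>, 0 :: real))"
      "indep_var (count_space UNIV) W (count_space UNIV) Z"
    using nonatomic_indep_copy[OF assms(1) W X0] by blast
  have m: "Z \<in> M \<rightarrow>\<^sub>M count_space UNIV" "(\<lambda>\<omega>. (X \<omega>, 0 :: real)) \<in> M \<rightarrow>\<^sub>M count_space UNIV"
    using Z(1) X0 by (auto intro: measurable_simple_function)
  have "distr (distr M (count_space UNIV) Z) borel fst =
      distr (distr M (count_space UNIV) (\<lambda>\<omega>. (X \<omega>, 0 :: real))) borel fst"
    using Z(2) by simp
  then have "same_distr M (\<lambda>\<omega>. fst (Z \<omega>)) X"
    using m by (simp add: same_distr_def distr_distr comp_def)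
  moreover have "simple_function M (\<lambda>\<omega>. fst (Z \<omega>))" using simple_function_compose1[OF Z(1)] .
  moreover have "indep_var (borel \<Otimes>\<^sub>M borel) (\<lambda>\<omega>. f (W \<omega>)) (borel \<Otimes>\<^sub>M borel) (\<lambda>\<omega>. g (fst (Z \<omega>)))"
    for f :: "_ \<Rightarrow> real \<times> real" and g :: "_ \<Rightarrow> real \<times> real"
    by (rule indep_var_map[OF Z(3)]) (auto simp: space_pair_measure)
  ultimately show thesis using that by blast
qed

end

subsection \<open>Representation of the preferences\<close>

locale combined_choices = prob_space M for M :: "'a measure" +
  fixes R1 R2 :: "('a \<Rightarrow> real) \<Rightarrow> ('a \<Rightarrow> real) \<Rightarrow> bool"
  assumes nonatomic: "nonatomic M"
    and complete1: "complete_on (Linfty M) R1" and trans1: "transp_on (Linfty M) R1"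
    and complete2: "complete_on (Linfty M) R2" and trans2: "transp_on (Linfty M) R2"
    and consistent: "consistency_of_combined_choices M R1 R2"
    and continuous1: "pref_continuous M R1" and continuous2: "pref_continuous M R2"
    and responsive1: "responsive M R1" and responsive2: "responsive M R2"
begin

text \<open>The axioms are symmetric in the two preferences, so whatever is proved for
  \<open>R1\<close> transfers to \<open>R2\<close>.\<close>

lemma swap: "combined_choices M R2 R1"
proof unfold_locales
  show "consistency_of_combined_choices M R2 R1"
    unfolding consistency_of_combined_choices_def
  proof (intro ballI impI)
    fix X X' Y Y'
    assume *: "X \<in> Linfty M" "X' \<in> Linfty M" "Y \<in> Linfty M" "Y' \<in> Linfty M"
      "indep_var (borel \<Otimes>\<^sub>M borel) (\<lambda>\<omega>. (X \<omega>, X' \<omega>)) (borel \<Otimes>\<^sub>M borel) (\<lambda>\<omega>. (Y \<omega>, Y' \<omega>))"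
      "strict_part R2 X X'" "strict_part R1 Y Y'"
    then have "\<not> strict_fosd M (\<lambda>\<omega>. Y' \<omega> + X' \<omega>) (\<lambda>\<omega>. Y \<omega> + X \<omega>)"
      using consistent indep_var_commute[OF *(5)] unfolding consistency_of_combined_choices_def by blast
    then show "\<not> strict_fosd M (\<lambda>\<omega>. X' \<omega> + Y' \<omega>) (\<lambda>\<omega>. X \<omega> + Y \<omega>)" by (simp add: add.commute)
  qed
qed (fact nonatomic complete1 trans1 complete2 trans2 continuous1 continuous2 responsive1 responsive2)+

text \<open>If \<open>Y\<close> were strictly preferred to \<open>X\<close>, continuity would give
  \<open>Y\<close> over \<open>X + e\<close> for some positive \<open>e\<close>. Together with the
  choice of \<open>e / 2\<close> over 0 by \<open>R2\<close>, whose constant options are independent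
  of everything, the rejected total \<open>X + e\<close> would strictly dominate the chosen
  \<open>Y + e / 2\<close>.\<close>

lemma pref_mono:
  assumes XY: "fosd M X Y" and X: "X \<in> Linfty M" and Y: "Y \<in> Linfty M"
  shows "R1 X Y"
proof (rule ccontr)
  assume "\<not> R1 X Y"
  then have "strict_part R1 Y X" using complete1 X Y by (auto simp: complete_on_def strict_part_def)
  then obtain e where e: "0 < e" "strict_part R1 Y (\<lambda>\<omega>. X \<omega> + e)"
    using continuous1 X Y unfolding pref_continuous_def by blast
  have r: "strict_part R2 (\<lambda>_. e / 2) (\<lambda>_. 0)"
    using responsive2[unfolded responsive_def, rule_format, OF Linfty_const[of 0], of "e / 2"] e by simp
  have "indep_var (borel \<Otimes>\<^sub>M borel) (\<lambda>\<omega>. (Y \<omega>, X \<omega> + e)) (borel \<Otimes>\<^sub>M borel) (\<lambda>\<omega>. (e / 2, 0))"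
    using Linfty_measurable[OF X] Linfty_measurable[OF Y]
    by (intro indep_var_const) (auto simp: space_pair_measure)
  then have "\<not> strict_fosd M (\<lambda>\<omega>. X \<omega> + e + 0) (\<lambda>\<omega>. Y \<omega> + e / 2)"
    using consistent[unfolded consistency_of_combined_choices_def, rule_format,
        OF Y Linfty_add_const[OF X] Linfty_const Linfty_const _ e(2) r] by blast
  then show False using strict_fosd_shift[OF XY X Y, of "e / 2" e] e by simp
qed

text \<open>The equivalent is the supremum of the constants to which \<open>X\<close> is weakly
  preferred, a set containing \<open>- K\<close> and bounded by \<open>K\<close>. Strict preference
  in either direction at the supremum would survive a small shift of the constant by continuity,
  contradicting that it is the least upper bound or that it is an upper bound.\<close>

lemma certainty_equivalent:
  assumes X: "X \<in> Linfty M"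
  shows "\<exists>c. R1 X (\<lambda>_. c) \<and> R1 (\<lambda>_. c) X"
proof -
  obtain K where K: "\<And>\<omega>. \<omega> \<in> space M \<Longrightarrow> \<bar>X \<omega>\<bar> \<le> K" using Linfty_bounded[OF X] by blast
  have cmono: "R1 (\<lambda>_. c) (\<lambda>_. d)" if "d \<le> c" for c d
    using that by (intro pref_mono fosd_mono Linfty_const) auto
  have lower: "R1 X (\<lambda>_. - K)" and upper: "R1 (\<lambda>_. K) X"
    using K Linfty_measurable[OF X]
    by (auto intro!: pref_mono fosd_mono Linfty_const X simp: abs_le_iff minus_le_iff)
  note tr = transp_onD[OF trans1]
  let ?S = "{c. R1 X (\<lambda>_. c)}"
  have bd: "c \<le> K" if "c \<in> ?S" for c
  proof (rule ccontr)
    assume "\<not> c \<le> K"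
    then have "strict_part R1 (\<lambda>_. K + (c - K)) (\<lambda>_. K)"
      using responsive1[unfolded responsive_def, rule_format, OF Linfty_const[of K], of "c - K"] by simp
    moreover have "R1 (\<lambda>_. K) (\<lambda>_. c)" using tr[OF _ _ _ upper, of "\<lambda>_. c"] that X Linfty_const by auto
    ultimately show False by (simp add: strict_part_def)
  qed
  have bdd: "bdd_above ?S" using bd by (rule bdd_aboveI)
  define c where "c = Sup ?S"
  have "R1 X (\<lambda>_. c)"
  proof (rule ccontr)
    assume "\<not> R1 X (\<lambda>_. c)"
    then have "strict_part R1 (\<lambda>_. c) X"
      using complete1 X Linfty_const by (auto simp: complete_on_def strict_part_def)
    then obtain e where e: "0 < e" "strict_part R1 (\<lambda>_. c - e) X"
      using continuous1 X Linfty_const unfolding pref_continuous_def by blast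
    then obtain s where s: "R1 X (\<lambda>_. s)" "c - e < s"
      using less_cSupE[of "c - e" ?S] lower unfolding c_def by auto
    then have "R1 X (\<lambda>_. c - e)" using tr[OF X Linfty_const Linfty_const s(1) cmono] by simp
    then show False using e by (simp add: strict_part_def)
  qed
  moreover have "R1 (\<lambda>_. c) X"
  proof (rule ccontr)
    assume "\<not> R1 (\<lambda>_. c) X"
    then have "strict_part R1 X (\<lambda>_. c)" using calculation by (simp add: strict_part_def)
    then obtain e where e: "0 < e" "strict_part R1 X (\<lambda>_. c + e)"
      using continuous1 X Linfty_const unfolding pref_continuous_def by blast
    then have "c + e \<le> c" using bdd unfolding c_def by (intro cSup_upper) (auto simp: strict_part_def)
    then show False using e by simp
  qed
  ultimately show ?thesis by blast
qed

lemma const_pref_iff: "R1 (\<lambda>_. c) (\<lambda>_. d) \<longleftrightarrow> d \<le> c"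
proof
  assume "d \<le> c"
  then show "R1 (\<lambda>_. c) (\<lambda>_. d)" by (intro pref_mono fosd_mono Linfty_const) auto
next
  assume *: "R1 (\<lambda>_. c) (\<lambda>_. d)"
  show "d \<le> c"
  proof (rule ccontr)
    assume "\<not> d \<le> c"
    then show False
      using responsive1[unfolded responsive_def, rule_format, OF Linfty_const[of c], of "d - c"] *
      by (simp add: strict_part_def)
  qed
qed

lemma representation: "\<exists>\<Phi>. represents M \<Phi> R1 \<and> (\<forall>c. \<Phi> (\<lambda>_. c) = c)"
proof -
  obtain \<Phi> where \<Phi>: "\<And>X. X \<in> Linfty M \<Longrightarrow> R1 X (\<lambda>_. \<Phi> X) \<and> R1 (\<lambda>_. \<Phi> X) X"
    using certainty_equivalent by metis
  have "R1 X Y \<longleftrightarrow> \<Phi> Y \<le> \<Phi> X" if X: "X \<in> Linfty M" and Y: "Y \<in> Linfty M" for X Y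
  proof -
    have "R1 X Y \<longleftrightarrow> R1 (\<lambda>_. \<Phi> X) (\<lambda>_. \<Phi> Y)"
      using \<Phi>[OF X] \<Phi>[OF Y] transp_onD[OF trans1] X Y Linfty_const by metis
    then show ?thesis by (simp add: const_pref_iff)
  qed
  moreover have "\<Phi> (\<lambda>_. c) = c" for c
    using \<Phi>[of "\<lambda>_. c"] const_pref_iff Linfty_const by (metis order_antisym)
  ultimately show ?thesis unfolding represents_def by blast
qed

end

section \<open>Agreement and additivity of the two representing statistics\<close>

locale combined_choices_representation = combined_choices +
  fixes \<Phi>1 \<Phi>2 :: "('a \<Rightarrow> real) \<Rightarrow> real"
  assumes rep1: "represents M \<Phi>1 R1" and rep2: "represents M \<Phi>2 R2"
    and const1: "\<Phi>1 (\<lambda>_. c) = c" and const2: "\<Phi>2 (\<lambda>_. c) = c"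
begin

lemma swap_representation: "combined_choices_representation M R2 R1 \<Phi>2 \<Phi>1"
  by (intro combined_choices_representation.intro combined_choices_representation_axioms.intro
      swap rep1 rep2 const1 const2)

lemma mono1: "fosd M X Y \<Longrightarrow> X \<in> Linfty M \<Longrightarrow> Y \<in> Linfty M \<Longrightarrow> \<Phi>1 Y \<le> \<Phi>1 X"
  using pref_mono rep1 by (auto simp: represents_def)

lemma mono1_pointwise:
  "X \<in> Linfty M \<Longrightarrow> Y \<in> Linfty M \<Longrightarrow> (\<And>\<omega>. \<omega> \<in> space M \<Longrightarrow> Y \<omega> \<le> X \<omega>) \<Longrightarrow> \<Phi>1 Y \<le> \<Phi>1 X"
  by (intro mono1 fosd_mono) (auto intro: Linfty_measurable)

lemma not_dominated:
  assumes "X \<in> Linfty M" "X' \<in> Linfty M" "Y \<in> Linfty M" "Y' \<in> Linfty M"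
    and "indep_var (borel \<Otimes>\<^sub>M borel) (\<lambda>\<omega>. (X \<omega>, X' \<omega>)) (borel \<Otimes>\<^sub>M borel) (\<lambda>\<omega>. (Y \<omega>, Y' \<omega>))"
    and "\<Phi>1 X' < \<Phi>1 X" "\<Phi>2 Y' < \<Phi>2 Y"
  shows "\<not> strict_fosd M (\<lambda>\<omega>. X' \<omega> + Y' \<omega>) (\<lambda>\<omega>. X \<omega> + Y \<omega>)"
proof -
  have "strict_part R1 X X'" "strict_part R2 Y Y'"
    using assms rep1 rep2 by (auto simp: represents_def strict_part_def)
  then show ?thesis using assms consistent unfolding consistency_of_combined_choices_def by blast
qed

text \<open>If X' is an independent copy of X, then X + d' and X' + c + d are ordered by comparing the
  constants, so choosing both X over d and d' over X' + c (or the opposite) would be inconsistent.\<close>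
lemma translation_simple:
  assumes X: "simple_function M X"
  shows "\<Phi>2 (\<lambda>\<omega>. X \<omega> + c) = \<Phi>1 X + c"
proof -
  interpret swapped: combined_choices_representation M R2 R1 \<Phi>2 \<Phi>1 by (rule swap_representation)
  have X0: "simple_function M (\<lambda>\<omega>. (X \<omega>, 0 :: real))"
    using simple_function_compose1[OF X, of "\<lambda>x. (x, 0)"] .
  obtain X' where X': "simple_function M X'" and same: "same_distr M X' X"
    and ind: "\<And>f g. indep_var (borel \<Otimes>\<^sub>M borel) (\<lambda>\<omega>. f (X \<omega>, 0 :: real) :: real \<times> real)
        (borel \<Otimes>\<^sub>M borel) (\<lambda>\<omega>. g (X' \<omega>))"
    using simple_indep_copy[OF nonatomic X0 X] by blast
  have L: "X \<in> Linfty M" "X' \<in> Linfty M" using X X' by (auto intro: simple_function_Linfty)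
  have same': "same_distr M X X'" using same by (simp add: same_distr_def)
  have dom: "fosd M X X'" "fosd M X' X"
    using same same' L by (auto intro!: same_distr_fosd Linfty_measurable)
  have ind1: "indep_var (borel \<Otimes>\<^sub>M borel) (\<lambda>\<omega>. (X \<omega>, d)) (borel \<Otimes>\<^sub>M borel) (\<lambda>\<omega>. (d', X' \<omega> + c))" for d d'
    using ind[of "\<lambda>p. (fst p, d)" "\<lambda>x. (d', x + c)"] by simp
  have ind2: "indep_var (borel \<Otimes>\<^sub>M borel) (\<lambda>\<omega>. (d, X \<omega>)) (borel \<Otimes>\<^sub>M borel) (\<lambda>\<omega>. (X' \<omega> + c, d'))" for d d'
    using ind[of "\<lambda>p. (d, fst p)" "\<lambda>x. (x + c, d')"] by simp
  have shift_dom: "fosd M (\<lambda>\<omega>. X \<omega> + c) (\<lambda>\<omega>. X' \<omega> + c)" "fosd M (\<lambda>\<omega>. X' \<omega> + c) (\<lambda>\<omega>. X \<omega> + c)"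
    using dom by (auto simp: fosd_def simp flip: le_diff_eq)
  then have eq: "\<Phi>2 (\<lambda>\<omega>. X' \<omega> + c) = \<Phi>2 (\<lambda>\<omega>. X \<omega> + c)"
    using L by (intro antisym swapped.mono1 Linfty_add_const)
  have "\<not> \<Phi>2 (\<lambda>\<omega>. X' \<omega> + c) < \<Phi>1 X + c"
  proof
    assume lt: "\<Phi>2 (\<lambda>\<omega>. X' \<omega> + c) < \<Phi>1 X + c"
    \<comment> \<open>The gap of \<open>3 * s\<close> is shared out equally: \<open>d\<close> lies
      \<open>s\<close> below the value of \<open>X\<close>, \<open>d'\<close> lies \<open>s\<close>
      above the value of \<open>X' + c\<close>, and \<open>d'\<close> is still \<open>s\<close>
      below \<open>c + d\<close>. The opposite case below reverses all three comparisons.\<close>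
    define s where "s = (\<Phi>1 X + c - \<Phi>2 (\<lambda>\<omega>. X' \<omega> + c)) / 3"
    define d where "d = \<Phi>1 X - s"
    define d' where "d' = \<Phi>2 (\<lambda>\<omega>. X' \<omega> + c) + s"
    have s: "d < \<Phi>1 X" "\<Phi>2 (\<lambda>\<omega>. X' \<omega> + c) < d'" "d' < c + d"
      using lt by (auto simp: s_def d_def d'_def field_simps)
    have "\<not> strict_fosd M (\<lambda>\<omega>. d + (X' \<omega> + c)) (\<lambda>\<omega>. X \<omega> + d')"
      using s by (intro not_dominated L Linfty_const Linfty_add_const ind1) (auto simp: const1 const2)
    moreover have "(\<lambda>\<omega>. d + (X' \<omega> + c)) = (\<lambda>\<omega>. X' \<omega> + (c + d))" by (simp add: fun_eq_iff)
    ultimately show False using strict_fosd_shift[OF dom(2) L(2,1) s(3)] by simp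
  qed
  moreover have "\<not> \<Phi>1 X + c < \<Phi>2 (\<lambda>\<omega>. X' \<omega> + c)"
  proof
    assume lt: "\<Phi>1 X + c < \<Phi>2 (\<lambda>\<omega>. X' \<omega> + c)"
    define s where "s = (\<Phi>2 (\<lambda>\<omega>. X' \<omega> + c) - (\<Phi>1 X + c)) / 3"
    define d where "d = \<Phi>1 X + s"
    define d' where "d' = \<Phi>2 (\<lambda>\<omega>. X' \<omega> + c) - s"
    have s: "\<Phi>1 X < d" "d' < \<Phi>2 (\<lambda>\<omega>. X' \<omega> + c)" "c + d < d'"
      using lt by (auto simp: s_def d_def d'_def field_simps)
    have "\<not> strict_fosd M (\<lambda>\<omega>. X \<omega> + d') (\<lambda>\<omega>. d + (X' \<omega> + c))"
      using s by (intro not_dominated L Linfty_const Linfty_add_const ind2) (auto simp: const1 const2)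
    moreover have "(\<lambda>\<omega>. d + (X' \<omega> + c)) = (\<lambda>\<omega>. X' \<omega> + (c + d))" by (simp add: fun_eq_iff)
    ultimately show False using strict_fosd_shift[OF dom(1) L s(3)] by simp
  qed
  ultimately show ?thesis using eq by simp
qed

text \<open>\<open>translation_simple\<close> evaluates \<open>\<Phi>2\<close> at
  \<open>X + c\<close> in two ways: from \<open>X\<close> with shift \<open>c\<close>, and from
  \<open>X + c\<close> with shift 0.\<close>

lemma translation1_simple:
  assumes X: "simple_function M X"
  shows "\<Phi>1 (\<lambda>\<omega>. X \<omega> + c) = \<Phi>1 X + c"
  using translation_simple[OF X, of c] translation_simple[OF simple_function_compose1[OF X, of "\<lambda>x. x + c"], of 0]
  by simp

text \<open>Rounding down to multiples of \<open>e\<close> gives a simple \<open>S\<close> with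
  \<open>X\<close> between \<open>S\<close> and \<open>S + e\<close>. The statistics agree on
  \<open>S\<close> by \<open>translation_simple\<close> with shift 0, so monotonicity leaves an
  error of at most \<open>e\<close>.\<close>

lemma representation_le:
  assumes X: "X \<in> Linfty M"
  shows "\<Phi>1 X \<le> \<Phi>2 X"
proof (rule field_le_epsilon)
  interpret swapped: combined_choices_representation M R2 R1 \<Phi>2 \<Phi>1 by (rule swap_representation)
  fix e :: real assume e: "0 < e"
  let ?S = "\<lambda>\<omega>. e * real_of_int \<lfloor>X \<omega> / e\<rfloor>"
  have S: "simple_function M ?S" using X by (rule simple_function_floor_Linfty)
  have SL: "?S \<in> Linfty M" using S by (rule simple_function_Linfty)
  have "\<Phi>1 X \<le> \<Phi>1 (\<lambda>\<omega>. ?S \<omega> + e)"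
    using X SL e by (intro mono1_pointwise Linfty_add_const floor_multiple_bounds)
  also have "\<dots> = \<Phi>1 ?S + e" by (rule translation1_simple[OF S])
  also have "\<Phi>1 ?S = \<Phi>2 ?S" using translation_simple[OF S, of 0] by simp
  also have "\<Phi>2 ?S \<le> \<Phi>2 X"
    using X SL e by (intro swapped.mono1_pointwise floor_multiple_bounds)
  finally show "\<Phi>1 X \<le> \<Phi>2 X + e" by simp
qed

lemma representations_eq: "X \<in> Linfty M \<Longrightarrow> \<Phi>1 X = \<Phi>2 X"
  using representation_le combined_choices_representation.representation_le[OF swap_representation]
  by (intro antisym)

text \<open>With X' a copy of X independent of (X, Y), the pair X + Y versus Y plus a constant and the pair
  consisting of a constant versus X' combine to X + Y and Y + X', which have the same distribution,
  up to constants.\<close>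
lemma additive_simple:
  assumes X: "simple_function M X" and Y: "simple_function M Y" and XY: "indep_var borel X borel Y"
  shows "\<Phi>1 (\<lambda>\<omega>. X \<omega> + Y \<omega>) = \<Phi>1 X + \<Phi>1 Y"
proof -
  have W: "simple_function M (\<lambda>\<omega>. (X \<omega>, Y \<omega>))" by (rule simple_function_Pair[OF X Y])
  obtain X' where X': "simple_function M X'" and same: "same_distr M X' X"
    and ind: "\<And>f g. indep_var (borel \<Otimes>\<^sub>M borel) (\<lambda>\<omega>. f (X \<omega>, Y \<omega>) :: real \<times> real)
        (borel \<Otimes>\<^sub>M borel) (\<lambda>\<omega>. g (X' \<omega>))"
    using simple_indep_copy[OF nonatomic W X] by blast
  have L: "X \<in> Linfty M" "Y \<in> Linfty M" "X' \<in> Linfty M"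
    using X Y X' by (auto intro: simple_function_Linfty)
  note [measurable] = L[THEN Linfty_measurable]
  have L': "(\<lambda>\<omega>. X \<omega> + Y \<omega>) \<in> Linfty M" "(\<lambda>\<omega>. X' \<omega> + Y \<omega>) \<in> Linfty M"
    using L by (auto intro: Linfty_add)
  have "indep_var (borel \<Otimes>\<^sub>M borel) (\<lambda>\<omega>. (Y \<omega>, 0 :: real)) (borel \<Otimes>\<^sub>M borel) (\<lambda>\<omega>. (X' \<omega>, 0 :: real))"
    using ind[of "\<lambda>p. (snd p, 0)" "\<lambda>x. (x, 0)"] by simp
  from indep_var_map[OF indep_var_commute[OF this], of fst borel fst borel]
  have X'Y: "indep_var borel X' borel Y" by simp
  \<comment> \<open>Both joint laws are products of their marginals, and the marginals coincide.
    Pushing forward along addition then compares the sums.\<close>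
  have "distr M (borel \<Otimes>\<^sub>M borel) (\<lambda>\<omega>. (X' \<omega>, Y \<omega>)) = distr M (borel \<Otimes>\<^sub>M borel) (\<lambda>\<omega>. (X \<omega>, Y \<omega>))"
    using XY X'Y same unfolding indep_var_distribution_eq same_distr_def by metis
  then have "distr (distr M (borel \<Otimes>\<^sub>M borel) (\<lambda>\<omega>. (X' \<omega>, Y \<omega>))) borel (\<lambda>p. fst p + snd p) =
      distr (distr M (borel \<Otimes>\<^sub>M borel) (\<lambda>\<omega>. (X \<omega>, Y \<omega>))) borel (\<lambda>p. fst p + snd p)" by simp
  then have sum: "same_distr M (\<lambda>\<omega>. X' \<omega> + Y \<omega>) (\<lambda>\<omega>. X \<omega> + Y \<omega>)"
    by (simp add: distr_distr comp_def same_distr_def)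
  have sum': "same_distr M (\<lambda>\<omega>. X \<omega> + Y \<omega>) (\<lambda>\<omega>. X' \<omega> + Y \<omega>)" using sum by (simp add: same_distr_def)
  have dom: "fosd M (\<lambda>\<omega>. X' \<omega> + Y \<omega>) (\<lambda>\<omega>. X \<omega> + Y \<omega>)" "fosd M (\<lambda>\<omega>. X \<omega> + Y \<omega>) (\<lambda>\<omega>. X' \<omega> + Y \<omega>)"
    using sum sum' by (auto intro!: same_distr_fosd)
  have "fosd M X' X" "fosd M X X'" using same by (auto intro!: same_distr_fosd simp: same_distr_def)
  then have \<Phi>X': "\<Phi>2 X' = \<Phi>1 X"
    using L by (auto simp flip: representations_eq intro!: antisym mono1)
  have \<Phi>Y: "\<Phi>1 (\<lambda>\<omega>. Y \<omega> + c) = \<Phi>1 Y + c" for c using Y by (rule translation1_simple)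
  have ind1: "indep_var (borel \<Otimes>\<^sub>M borel) (\<lambda>\<omega>. (X \<omega> + Y \<omega>, Y \<omega> + c)) (borel \<Otimes>\<^sub>M borel) (\<lambda>\<omega>. (d, X' \<omega>))" for c d
    using ind[of "\<lambda>p. (fst p + snd p, snd p + c)" "\<lambda>x. (d, x)"] by simp
  have ind2: "indep_var (borel \<Otimes>\<^sub>M borel) (\<lambda>\<omega>. (Y \<omega> + c, X \<omega> + Y \<omega>)) (borel \<Otimes>\<^sub>M borel) (\<lambda>\<omega>. (X' \<omega>, d))" for c d
    using ind[of "\<lambda>p. (snd p + c, fst p + snd p)" "\<lambda>x. (x, d)"] by simp
  \<comment> \<open>A third of the signed additivity defect. With these constants the value of
    \<open>X + Y\<close> exceeds that of \<open>Y + c\<close> by \<open>s\<close>, \<open>d\<close>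
    exceeds the value of \<open>X'\<close> by \<open>s\<close>, and \<open>c\<close> exceeds
    \<open>d\<close> by \<open>s\<close>, so one choice of \<open>c\<close> and \<open>d\<close>
    serves both signs.\<close>
  define s where "s = (\<Phi>1 (\<lambda>\<omega>. X \<omega> + Y \<omega>) - (\<Phi>1 X + \<Phi>1 Y)) / 3"
  define c where "c = \<Phi>1 X + 2 * s"
  define d where "d = \<Phi>1 X + s"
  have \<Phi>sum: "\<Phi>1 (\<lambda>\<omega>. X \<omega> + Y \<omega>) = \<Phi>1 X + \<Phi>1 Y + 3 * s" by (simp add: s_def field_simps)
  have \<Phi>Yc: "\<Phi>1 (\<lambda>\<omega>. Y \<omega> + c) = \<Phi>1 X + \<Phi>1 Y + 2 * s" by (simp add: \<Phi>Y c_def)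
  have eq: "(\<lambda>\<omega>. Y \<omega> + c + X' \<omega>) = (\<lambda>\<omega>. (X' \<omega> + Y \<omega>) + c)" by (simp add: fun_eq_iff)
  have "\<not> 0 < s"
  proof
    assume s: "0 < s"
    have "\<not> strict_fosd M (\<lambda>\<omega>. Y \<omega> + c + X' \<omega>) (\<lambda>\<omega>. X \<omega> + Y \<omega> + d)"
      using s by (intro not_dominated L L' Linfty_const Linfty_add_const ind1)
        (simp_all add: const2 \<Phi>X' \<Phi>sum \<Phi>Yc d_def)
    moreover have "d < c" using s by (simp add: c_def d_def)
    ultimately show False using strict_fosd_shift[OF dom(1) L'(2,1)] unfolding eq by simp
  qed
  moreover have "\<not> s < 0"
  proof
    assume s: "s < 0"
    have "\<not> strict_fosd M (\<lambda>\<omega>. X \<omega> + Y \<omega> + d) (\<lambda>\<omega>. Y \<omega> + c + X' \<omega>)"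
      using s by (intro not_dominated L L' Linfty_const Linfty_add_const ind2)
        (simp_all add: const2 \<Phi>X' \<Phi>sum \<Phi>Yc d_def)
    moreover have "c < d" using s by (simp add: c_def d_def)
    ultimately show False using strict_fosd_shift[OF dom(2) L'] unfolding eq by simp
  qed
  ultimately show ?thesis by (simp add: s_def)
qed

text \<open>Rounding with the Borel function \<open>h\<close> preserves independence, so additivity
  holds for the rounded variables. Both sides of the claim then lie in the same interval of length
  \<open>2 * e\<close>, for every positive \<open>e\<close>.\<close>

lemma additive:
  assumes X: "X \<in> Linfty M" and Y: "Y \<in> Linfty M" and XY: "indep_var borel X borel Y"
  shows "\<Phi>1 (\<lambda>\<omega>. X \<omega> + Y \<omega>) = \<Phi>1 X + \<Phi>1 Y"
proof -
  have bound: "\<bar>\<Phi>1 (\<lambda>\<omega>. X \<omega> + Y \<omega>) - (\<Phi>1 X + \<Phi>1 Y)\<bar> \<le> 2 * e" if e: "0 < e" for e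
  proof -
    define h where "h x = e * real_of_int \<lfloor>x / e\<rfloor>" for x
    let ?S = "\<lambda>\<omega>. h (X \<omega>)" and ?T = "\<lambda>\<omega>. h (Y \<omega>)"
    have h: "h x \<le> x" "x \<le> h x + e" for x unfolding h_def using e by (rule floor_multiple_bounds)+
    have [measurable]: "h \<in> borel_measurable borel" unfolding h_def by measurable
    have S: "simple_function M ?S" and T: "simple_function M ?T"
      unfolding h_def using X Y by (auto intro: simple_function_floor_Linfty)
    have ST: "simple_function M (\<lambda>\<omega>. ?S \<omega> + ?T \<omega>)" using S T by (rule simple_function_add)
    note L = S[THEN simple_function_Linfty] T[THEN simple_function_Linfty] ST[THEN simple_function_Linfty]
    have ind: "indep_var borel ?S borel ?T" using XY by (rule indep_var_map) measurable
    have sum: "\<Phi>1 (\<lambda>\<omega>. ?S \<omega> + ?T \<omega>) = \<Phi>1 ?S + \<Phi>1 ?T" by (rule additive_simple[OF S T ind])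
    have "\<Phi>1 ?S \<le> \<Phi>1 X" "\<Phi>1 ?T \<le> \<Phi>1 Y"
      using h X Y L by (auto intro!: mono1_pointwise)
    moreover have "\<Phi>1 X \<le> \<Phi>1 ?S + e" "\<Phi>1 Y \<le> \<Phi>1 ?T + e"
      using h X Y L by (auto intro!: mono1_pointwise Linfty_add_const simp flip: translation1_simple[OF S] translation1_simple[OF T])
    moreover have "\<Phi>1 (\<lambda>\<omega>. ?S \<omega> + ?T \<omega>) \<le> \<Phi>1 (\<lambda>\<omega>. X \<omega> + Y \<omega>)"
      using h X Y L by (intro mono1_pointwise Linfty_add add_mono)
    moreover have "\<Phi>1 (\<lambda>\<omega>. X \<omega> + Y \<omega>) \<le> \<Phi>1 (\<lambda>\<omega>. ?S \<omega> + ?T \<omega> + 2 * e)"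
    proof (intro mono1_pointwise Linfty_add Linfty_const X Y L)
      fix \<omega> show "X \<omega> + Y \<omega> \<le> ?S \<omega> + ?T \<omega> + 2 * e" using h(2)[of "X \<omega>"] h(2)[of "Y \<omega>"] by simp
    qed
    ultimately show ?thesis using sum translation1_simple[OF ST, of "2 * e"] by linarith
  qed
  have "\<bar>\<Phi>1 (\<lambda>\<omega>. X \<omega> + Y \<omega>) - (\<Phi>1 X + \<Phi>1 Y)\<bar> \<le> 0 + e" if "0 < e" for e
    using bound[of "e / 2"] that by simp
  then have "\<bar>\<Phi>1 (\<lambda>\<omega>. X \<omega> + Y \<omega>) - (\<Phi>1 X + \<Phi>1 Y)\<bar> \<le> 0" by (rule field_le_epsilon)
  then show ?thesis by simp
qed

text \<open>Invariance under equality in distribution comes from monotonicity, since variables with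
  the same law dominate each other.\<close>

lemma monotone_additive: "monotone_additive_statistic M \<Phi>1"
proof -
  have "\<Phi>1 X = \<Phi>1 Y" if "X \<in> Linfty M" "Y \<in> Linfty M" "same_distr M X Y" for X Y
  proof -
    have "fosd M X Y" "fosd M Y X"
      using that by (auto intro!: same_distr_fosd simp: Linfty_measurable same_distr_def)
    then show ?thesis using that by (intro antisym mono1)
  qed
  then show ?thesis
    unfolding monotone_additive_statistic_def using const1 additive mono1 by blast
qed

end

subsection \<open>Preferences represented by a statistic\<close>

context prob_space
begin

lemma statistic_add:
  assumes "monotone_additive_statistic M \<Phi>" "X \<in> Linfty M" "Y \<in> Linfty M" "indep_var borel X borel Y"
  shows "\<Phi> (\<lambda>\<omega>. X \<omega> + Y \<omega>) = \<Phi> X + \<Phi> Y"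
  using assms by (simp add: monotone_additive_statistic_def)

text \<open>A constant is independent of every random variable, so this is a case of
  additivity.\<close>

lemma statistic_add_const:
  assumes "monotone_additive_statistic M \<Phi>" "X \<in> Linfty M"
  shows "\<Phi> (\<lambda>\<omega>. X \<omega> + c) = \<Phi> X + c"
proof -
  have "indep_var borel X borel (\<lambda>_. c)" using assms by (intro indep_var_const Linfty_measurable) auto
  from statistic_add[OF assms Linfty_const this] show ?thesis
    using assms(1) by (simp add: monotone_additive_statistic_def)
qed

lemma represents_strict_part:
  assumes "represents M \<Phi> R" "X \<in> Linfty M" "Y \<in> Linfty M"
  shows "strict_part R X Y \<longleftrightarrow> \<Phi> Y < \<Phi> X"
  using assms by (auto simp: represents_def strict_part_def)

lemma statistic_responsive:
  assumes "monotone_additive_statistic M \<Phi>" "represents M \<Phi> R"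
  shows "responsive M R"
  unfolding responsive_def
  using assms by (simp add: represents_strict_part Linfty_add_const statistic_add_const)

lemma statistic_continuous:
  assumes \<Phi>: "monotone_additive_statistic M \<Phi>" "represents M \<Phi> R"
  shows "pref_continuous M R"
  unfolding pref_continuous_def
proof (intro ballI impI)
  fix X Y assume X: "X \<in> Linfty M" and Y: "Y \<in> Linfty M" and XY: "strict_part R X Y"
  \<comment> \<open>Half of the gap: a shift by this amount on either side leaves the preference
    strict.\<close>
  define e where "e = (\<Phi> X - \<Phi> Y) / 2"
  have "\<Phi> Y < \<Phi> X" using XY represents_strict_part[OF \<Phi>(2) X Y] by simp
  then have e: "0 < e" "\<Phi> Y + e < \<Phi> X" by (auto simp: e_def field_simps)
  have "\<Phi> (\<lambda>\<omega>. X \<omega> - e) = \<Phi> X - e" using statistic_add_const[OF \<Phi>(1) X, of "- e"] by simp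
  then have "strict_part R X (\<lambda>\<omega>. Y \<omega> + e)" "strict_part R (\<lambda>\<omega>. X \<omega> - e) Y"
    using e X Y by (simp_all add: represents_strict_part[OF \<Phi>(2)] Linfty_add_const Linfty_diff_const
        statistic_add_const[OF \<Phi>(1)])
  then show "\<exists>e>0. strict_part R X (\<lambda>\<omega>. Y \<omega> + e) \<and> strict_part R (\<lambda>\<omega>. X \<omega> - e) Y"
    using e by blast
qed

text \<open>Projecting the independent pairs makes \<open>X\<close> independent of \<open>Y\<close>
  and \<open>X'\<close> of \<open>Y'\<close>, so the statistic is additive on both totals. The
  chosen total then has the strictly larger value, which monotonicity forbids if the rejected one
  dominates it.\<close>

lemma statistic_consistent:
  assumes \<Phi>: "monotone_additive_statistic M \<Phi>" "represents M \<Phi> R1" "represents M \<Phi> R2"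
  shows "consistency_of_combined_choices M R1 R2"
  unfolding consistency_of_combined_choices_def
proof (intro ballI impI notI)
  fix X X' Y Y'
  assume L: "X \<in> Linfty M" "X' \<in> Linfty M" "Y \<in> Linfty M" "Y' \<in> Linfty M"
    and ind: "indep_var (borel \<Otimes>\<^sub>M borel) (\<lambda>\<omega>. (X \<omega>, X' \<omega>)) (borel \<Otimes>\<^sub>M borel) (\<lambda>\<omega>. (Y \<omega>, Y' \<omega>))"
    and pref: "strict_part R1 X X'" "strict_part R2 Y Y'"
    and dom: "strict_fosd M (\<lambda>\<omega>. X' \<omega> + Y' \<omega>) (\<lambda>\<omega>. X \<omega> + Y \<omega>)"
  have "indep_var borel X borel Y" "indep_var borel X' borel Y'"
    using indep_var_map[OF ind, of fst borel fst borel] indep_var_map[OF ind, of snd borel snd borel] by auto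
  then have "\<Phi> (\<lambda>\<omega>. X \<omega> + Y \<omega>) = \<Phi> X + \<Phi> Y" "\<Phi> (\<lambda>\<omega>. X' \<omega> + Y' \<omega>) = \<Phi> X' + \<Phi> Y'"
    using statistic_add[OF \<Phi>(1)] L by auto
  moreover have "\<Phi> X' < \<Phi> X" "\<Phi> Y' < \<Phi> Y"
    using pref L \<Phi> represents_strict_part by blast+
  moreover have "\<Phi> (\<lambda>\<omega>. X \<omega> + Y \<omega>) \<le> \<Phi> (\<lambda>\<omega>. X' \<omega> + Y' \<omega>)"
    using \<Phi>(1) L dom Linfty_add unfolding monotone_additive_statistic_def strict_fosd_def by blast
  ultimately show False by simp
qed

end

theorem theorem5:
  fixes M :: "'a measure"
    and R1 R2 :: "('a \<Rightarrow> real) \<Rightarrow> ('a \<Rightarrow> real) \<Rightarrow> bool"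
  assumes "prob_space M" and "nonatomic M"
    and "complete_on (Linfty M) R1" and "transp_on (Linfty M) R1"
    and "complete_on (Linfty M) R2" and "transp_on (Linfty M) R2"
  shows "(consistency_of_combined_choices M R1 R2 \<and>
          pref_continuous M R1 \<and> pref_continuous M R2 \<and>
          responsive M R1 \<and> responsive M R2) \<longleftrightarrow>
         (\<exists>\<Phi>. monotone_additive_statistic M \<Phi> \<and> represents M \<Phi> R1 \<and> represents M \<Phi> R2)"
    (is "?axioms \<longleftrightarrow> ?statistic")
proof
  assume ?axioms
  then interpret cc: combined_choices M R1 R2
    using assms by (intro combined_choices.intro combined_choices_axioms.intro) auto
  obtain \<Phi>1 \<Phi>2 where "represents M \<Phi>1 R1" "\<And>c. \<Phi>1 (\<lambda>_. c) = c" "represents M \<Phi>2 R2" "\<And>c. \<Phi>2 (\<lambda>_. c) = c"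
    using cc.representation combined_choices.representation[OF cc.swap] by auto
  then interpret cr: combined_choices_representation M R1 R2 \<Phi>1 \<Phi>2 by unfold_locales
  have "represents M \<Phi>1 R2" using cr.rep2 by (simp add: represents_def cr.representations_eq)
  then show ?statistic using cr.monotone_additive cr.rep1 by blast
next
  interpret prob_space M by fact
  assume ?statistic
  then show ?axioms using statistic_consistent statistic_continuous statistic_responsive by blast
qed

end
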